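(* For every integer $d\ge0$, the image of $\Psi_d\colon\mathrm{Mat}_d\to\mathrm{WQSym}_d$ has dimension at least $2^d-d$. Specifically, there is a collection of $2^d-d$ Schubert matroids on $[d]$ whose chromatic word-quasisymmetric functions $\Psi(M)$ are linearly independent.
   Context: $[d]=\{1,\dots,d\}$, $[0]=\emptyset$. For a matroid $M$ on $[d]$, $f\colon[d]\to\mathbb R$ and a basis $B$ put $f(B)=\sum_{i\in B}f(i)$; $f$ is $M$-generic if there is a unique basis $B$ of $M$ maximizing $f(B)$. Let $w_1,w_2,\dots$ be non-commuting variables and $w_f=w_{f(1)}w_{f(2)}\cdots w_{f(d)}$ for $f\colon[d]\to\mathbb Z_{\ge1}$. The chromatic word-quasisymmetric function of $M$ is $\Psi(M)=\sum_{f} w_f$, the sum over all $M$-generic $f\colon[d]\to\mathbb Z_{\ge 1}$. The set composition type of $f$ is the ordered partition of $[d]$ into the level sets of $f$, listed by increasing value. $\mathrm{WQSym}_d$ is the real vector space of formal series $\sum_{f:[d]\to\mathbb Z_{\ge1}}c_fw_f$ with $c_f=c_g$ whenever $f,g$ have the same set composition type. $\mathrm{Mat}_d$ is the real vector space with basis all matroids with ground set $[d]$, and $\Psi_d$ is the linear extension of $M\mapsto\Psi(M)$. For $A=\{a_1<\dots<a_r\}\subseteq[d]$, the Schubert matroid $\mathrm{SM}(A)$ is the matroid on $[d]$ whose bases are the sets $B=\{b_1<\dots<b_r\}\subseteq[d]$ with $b_i\le a_i$ for all $i=1,\dots,r$. *)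

theory Defs
  imports
    "HOL-Library.Function_Algebras"
    "HOL-Analysis.Finite_Function_Topology"
begin

section \<open>Matroids\<close>

text \<open>A matroid on the ground set \<open>E\<close> is given by its family of bases.\<close>

definition matroid_on :: "'a set \<Rightarrow> 'a set set \<Rightarrow> bool" where
  "matroid_on E M \<longleftrightarrow> finite E \<and> M \<noteq> {} \<and> (\<forall>B\<in>M. B \<subseteq> E) \<and>
     (\<forall>B\<in>M. \<forall>B'\<in>M. \<forall>x\<in>B - B'. \<exists>y\<in>B' - B. insert y (B - {x}) \<in> M)"

definition generic :: "'a set set \<Rightarrow> ('a \<Rightarrow> real) \<Rightarrow> bool" where
  "generic M f \<longleftrightarrow> (\<exists>!B. is_arg_max (\<lambda>B. \<Sum>i\<in>B. f i) (\<lambda>B. B \<in> M) B)"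

text \<open>\<open>sorted_list_of_set\<close> lists the elements in increasing order, so the condition compares
  the \<open>i\<close>-th smallest elements (indexed from \<open>0\<close>).\<close>

definition schubert_matroid :: "nat \<Rightarrow> nat set \<Rightarrow> nat set set" where
  "schubert_matroid d A =
     {B. B \<subseteq> {1..d} \<and> card B = card A \<and>
         (\<forall>i<card A. sorted_list_of_set B ! i \<le> sorted_list_of_set A ! i)}"

section \<open>Formal series in non-commuting variables\<close>

instantiation "fun" :: (type, real_vector) real_vector
begin

definition scaleR_fun :: "real \<Rightarrow> ('a \<Rightarrow> 'b) \<Rightarrow> 'a \<Rightarrow> 'b" where
  "scaleR_fun r f = (\<lambda>x. r *\<^sub>R f x)"

instance
  by standard (auto simp: scaleR_fun_def fun_eq_iff scaleR_add_right scaleR_add_left)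

end

lemma scaleR_fun_apply [simp]: "(r *\<^sub>R f) x = r *\<^sub>R f x"
  by (simp add: scaleR_fun_def)

text \<open>The monomial \<open>w\<^bsub>k\<^sub>1\<^esub> \<dots> w\<^bsub>k\<^sub>n\<^esub>\<close> is the word \<open>[k\<^sub>1, \<dots>, k\<^sub>n]\<close>; a formal series is its coefficient
  function.\<close>

type_synonym word_series = "nat list \<Rightarrow> real"

definition colorings :: "nat \<Rightarrow> (nat \<Rightarrow> nat) set" where
  "colorings d = {1..d} \<rightarrow>\<^sub>E {1..}"

definition color_word :: "nat \<Rightarrow> (nat \<Rightarrow> nat) \<Rightarrow> nat list" where
  "color_word d f = map f [1..<Suc d]"

definition set_comp_type :: "nat \<Rightarrow> (nat \<Rightarrow> nat) \<Rightarrow> nat set list" where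
  "set_comp_type d f = map (\<lambda>k. {i\<in>{1..d}. f i = k}) (sorted_list_of_set (f ` {1..d}))"

definition WQSym :: "nat \<Rightarrow> word_series set" where
  "WQSym d = {c. (\<forall>u. c u \<noteq> 0 \<longrightarrow> u \<in> color_word d ` colorings d) \<and>
     (\<forall>f\<in>colorings d. \<forall>g\<in>colorings d.
        set_comp_type d f = set_comp_type d g \<longrightarrow> c (color_word d f) = c (color_word d g))}"

text \<open>The coefficient of a word \<open>u\<close> in the formal sum of all \<open>w\<^sub>f\<close>, \<open>f\<close> generic, is the number
  of generic \<open>f\<close> with \<open>w\<^sub>f = u\<close> (which is \<open>0\<close> or \<open>1\<close>).\<close>

definition Psi :: "nat \<Rightarrow> nat set set \<Rightarrow> word_series" where
  "Psi d M = (\<lambda>u. real (card {f \<in> colorings d. generic M (\<lambda>i. real (f i)) \<and> color_word d f = u}))"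

text \<open>Inside the free real vector space on all set families, \<open>Mat d\<close> is the subspace spanned by
  the matroids on \<open>{1..d}\<close>; the basis vector of \<open>M\<close> is \<open>Poly_Mapping.single M 1\<close>.\<close>

definition Mat :: "nat \<Rightarrow> (nat set set \<Rightarrow>\<^sub>0 real) set" where
  "Mat d = {p. Poly_Mapping.keys p \<subseteq> {M. matroid_on {1..d} M}}"

definition Psi_lin :: "nat \<Rightarrow> (nat set set \<Rightarrow>\<^sub>0 real) \<Rightarrow> word_series" where
  "Psi_lin d p = (\<Sum>M\<in>Poly_Mapping.keys p. Poly_Mapping.lookup p M *\<^sub>R Psi d M)"

section \<open>Well-definedness\<close>

lemma lookup_scaleR_pm:
  "Poly_Mapping.lookup (r *\<^sub>R p) x = r *\<^sub>R Poly_Mapping.lookup p x"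
  for p :: "'a \<Rightarrow>\<^sub>0 'b::real_vector"
proof -
  have "finite {i. r *\<^sub>R Poly_Mapping.lookup p i \<noteq> 0}"
    by (rule finite_subset[OF _ finite_lookup[of p]]) auto
  then show ?thesis
    by (simp add: scaleR_poly_mapping_def Abs_poly_mapping_inverse)
qed

lemma subspace_Mat: "subspace (Mat d)"
proof -
  have "Poly_Mapping.keys (p + q) \<subseteq> Poly_Mapping.keys p \<union> Poly_Mapping.keys q"
    "Poly_Mapping.keys (r *\<^sub>R p) \<subseteq> Poly_Mapping.keys p"
    for p q :: "nat set set \<Rightarrow>\<^sub>0 real" and r
    by (auto simp: in_keys_iff lookup_add lookup_scaleR_pm)
  then show ?thesis
    unfolding subspace_def Mat_def by (simp, blast)
qed

lemma Psi_lin_superset: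
  assumes "finite S" "Poly_Mapping.keys p \<subseteq> S"
  shows "Psi_lin d p = (\<Sum>M\<in>S. Poly_Mapping.lookup p M *\<^sub>R Psi d M)"
  unfolding Psi_lin_def
  by (rule sum.mono_neutral_left) (use assms in \<open>auto simp: in_keys_iff\<close>)

lemma Psi_lin_single [simp]: "Psi_lin d (Poly_Mapping.single M 1) = Psi d M"
  by (simp add: Psi_lin_def)

lemma linear_Psi_lin: "linear (Psi_lin d)"
proof (rule linearI)
  fix p q :: "nat set set \<Rightarrow>\<^sub>0 real" and r :: real
  let ?S = "Poly_Mapping.keys p \<union> Poly_Mapping.keys q"
  have "Psi_lin d (p + q) = (\<Sum>M\<in>?S. Poly_Mapping.lookup (p + q) M *\<^sub>R Psi d M)"
    by (rule Psi_lin_superset) (auto simp: Poly_Mapping.keys_add)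
  also have "\<dots> = Psi_lin d p + Psi_lin d q"
    by (simp add: Psi_lin_superset[of ?S] lookup_add scaleR_add_left sum.distrib)
  finally show "Psi_lin d (p + q) = Psi_lin d p + Psi_lin d q" .
  have "Psi_lin d (r *\<^sub>R p) =
      (\<Sum>M\<in>Poly_Mapping.keys p. Poly_Mapping.lookup (r *\<^sub>R p) M *\<^sub>R Psi d M)"
    by (rule Psi_lin_superset) (auto simp: in_keys_iff lookup_scaleR_pm)
  then show "Psi_lin d (r *\<^sub>R p) = r *\<^sub>R Psi_lin d p"
    by (simp add: lookup_scaleR_pm Psi_lin_def scaleR_sum_right)
qed

lemma subspace_WQSym: "subspace (WQSym d)"
proof (rule subspaceI)
  show "0 \<in> WQSym d"
    by (simp add: WQSym_def)
next
  fix x y assume xy: "x \<in> WQSym d" "y \<in> WQSym d"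
  have "u \<in> color_word d ` colorings d" if "(x + y) u \<noteq> 0" for u
  proof (cases "x u = 0")
    case True
    then show ?thesis using that xy(2) by (simp add: WQSym_def)
  next
    case False
    then show ?thesis using xy(1) by (simp add: WQSym_def)
  qed
  moreover have "(x + y) (color_word d f) = (x + y) (color_word d g)"
    if "f \<in> colorings d" "g \<in> colorings d" "set_comp_type d f = set_comp_type d g" for f g
    using xy that unfolding WQSym_def plus_fun_apply mem_Collect_eq by metis
  ultimately show "x + y \<in> WQSym d"
    unfolding WQSym_def by blast
next
  fix r x assume x: "x \<in> WQSym d"
  have "u \<in> color_word d ` colorings d" if "(r *\<^sub>R x) u \<noteq> 0" for u
    using that x by (simp add: WQSym_def)
  moreover have "(r *\<^sub>R x) (color_word d f) = (r *\<^sub>R x) (color_word d g)"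
    if "f \<in> colorings d" "g \<in> colorings d" "set_comp_type d f = set_comp_type d g" for f g
    using x that unfolding WQSym_def scaleR_fun_apply mem_Collect_eq by metis
  ultimately show "r *\<^sub>R x \<in> WQSym d"
    unfolding WQSym_def by blast
qed

text \<open>Genericity depends only on the relative order of the weights; hence \<open>Psi d M \<in> WQSym d\<close>
  for every matroid \<open>M\<close>.\<close>

lemma generic_iff_exchange:
  assumes M: "matroid_on E M"
  shows "generic M f \<longleftrightarrow>
    (\<exists>B\<in>M. \<forall>x\<in>B. \<forall>y\<in>E - B. insert y (B - {x}) \<in> M \<longrightarrow> f y < f x)"
proof -
  let ?w = "\<lambda>B. \<Sum>i\<in>B. f i"
  have finE: "finite E" and ne: "M \<noteq> {}" and sub: "\<And>B. B \<in> M \<Longrightarrow> B \<subseteq> E"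
    and exch: "\<And>B B' x. B \<in> M \<Longrightarrow> B' \<in> M \<Longrightarrow> x \<in> B - B' \<Longrightarrow>
                 \<exists>y\<in>B' - B. insert y (B - {x}) \<in> M"
    using M by (auto simp: matroid_on_def)
  have finM: "finite M"
    by (rule finite_subset[of _ "Pow E"]) (use finE sub in auto)
  have finB: "finite B" if "B \<in> M" for B
    using finite_subset[OF sub[OF that] finE] .
  have swap: "?w (insert y (B - {x})) = ?w B - f x + f y" if "B \<in> M" "x \<in> B" "y \<notin> B" for B x y
    using that finB[OF that(1)] by (simp add: sum_diff1)
  have max_iff: "is_arg_max ?w (\<lambda>B. B \<in> M) B \<longleftrightarrow> B \<in> M \<and> (\<forall>B'\<in>M. ?w B' \<le> ?w B)" for B
    by (auto simp: is_arg_max_linorder)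
  show ?thesis
  proof
    assume "generic M f"
    then obtain B where "is_arg_max ?w (\<lambda>B. B \<in> M) B"
      and "\<And>B'. is_arg_max ?w (\<lambda>B. B \<in> M) B' \<Longrightarrow> B' = B"
      unfolding generic_def by metis
    then have B: "B \<in> M" "\<And>B'. B' \<in> M \<Longrightarrow> ?w B' \<le> ?w B"
      and uniq: "\<And>B'. B' \<in> M \<Longrightarrow> (\<forall>B''\<in>M. ?w B'' \<le> ?w B') \<Longrightarrow> B' = B"
      by (metis max_iff)+
    have "f y < f x" if "x \<in> B" "y \<in> E - B" "insert y (B - {x}) \<in> M" for x y
    proof (rule ccontr)
      assume "\<not> f y < f x"
      then have "?w B \<le> ?w (insert y (B - {x}))"
        using swap[of B x y] that B(1) by auto
      then have "insert y (B - {x}) = B"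
        using uniq[OF that(3)] B(2) by (meson order_trans)
      then show False using that by blast
    qed
    with B(1) show "\<exists>B\<in>M. \<forall>x\<in>B. \<forall>y\<in>E - B. insert y (B - {x}) \<in> M \<longrightarrow> f y < f x"
      by blast
  next
    assume "\<exists>B\<in>M. \<forall>x\<in>B. \<forall>y\<in>E - B. insert y (B - {x}) \<in> M \<longrightarrow> f y < f x"
    then obtain B where B: "B \<in> M"
      and loc: "\<And>x y. x \<in> B \<Longrightarrow> y \<in> E - B \<Longrightarrow> insert y (B - {x}) \<in> M \<Longrightarrow> f y < f x"
      by blast
    have eqB: "B' = B" if B': "B' \<in> M" "\<And>B''. B'' \<in> M \<Longrightarrow> ?w B'' \<le> ?w B'" for B'
    proof (rule ccontr)
      assume "B' \<noteq> B"
      then have "B - B' \<noteq> {}" "B' - B \<noteq> {}"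
        using exch[OF B B'(1)] exch[OF B'(1) B] by blast+
      moreover have "finite (B - B')" "finite (B' - B)"
        using finB B B'(1) by auto
      ultimately obtain z x where z: "z \<in> B - B'" "\<And>y. y \<in> B - B' \<Longrightarrow> f z \<le> f y"
        and x: "x \<in> B' - B" "\<And>y. y \<in> B' - B \<Longrightarrow> f x \<le> f y"
        by (metis ex_is_arg_min_if_finite is_arg_min_linorder)
      obtain y' where "y' \<in> B' - B" "insert y' (B - {z}) \<in> M"
        using exch[OF B B'(1) z(1)] by blast
      then have "f x < f z"
        using loc[of z y'] z(1) sub[OF B'(1)] x(2)[of y'] by force
      moreover obtain y where y: "y \<in> B - B'" "insert y (B' - {x}) \<in> M"
        using exch[OF B'(1) B x(1)] by blast
      ultimately have "?w B' < ?w (insert y (B' - {x}))"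
        using swap[of B' x y] x(1) z(2)[of y] B'(1) by auto
      then show False
        using B'(2)[OF y(2)] by simp
    qed
    have "Max (?w ` M) \<in> ?w ` M"
      using finM ne by (intro Max_in) auto
    then obtain B' where B': "B' \<in> M" "?w B' = Max (?w ` M)"
      by (metis imageE)
    have max: "?w B'' \<le> ?w B'" if "B'' \<in> M" for B''
      unfolding B'(2) using finM that by (intro Max_ge) auto
    have "B' = B"
      using eqB[OF B'(1) max] .
    with B'(1) max have "is_arg_max ?w (\<lambda>B. B \<in> M) B"
      unfolding max_iff by metis
    moreover have "B'' = B" if "is_arg_max ?w (\<lambda>B. B \<in> M) B''" for B''
      by (rule eqB) (use that max_iff in metis)+
    ultimately show "generic M f"
      unfolding generic_def by metis
  qed
qed

lemma set_comp_type_index: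
  assumes "i \<in> {1..d}"
  obtains k where "k < length (set_comp_type d f)" "i \<in> set_comp_type d f ! k"
    "sorted_list_of_set (f ` {1..d}) ! k = f i"
proof -
  have "f i \<in> set (sorted_list_of_set (f ` {1..d}))"
    using assms by simp
  then obtain k where "k < length (sorted_list_of_set (f ` {1..d}))"
    "sorted_list_of_set (f ` {1..d}) ! k = f i"
    by (metis in_set_conv_nth)
  with that show thesis
    using assms by (auto simp: set_comp_type_def)
qed

lemma set_comp_type_eq_imp_less:
  assumes "set_comp_type d f = set_comp_type d g" "i \<in> {1..d}" "j \<in> {1..d}" "f i < f j"
  shows "g i < g j"
proof -
  let ?F = "sorted_list_of_set (f ` {1..d})" and ?G = "sorted_list_of_set (g ` {1..d})"
  have len: "length (set_comp_type d f) = length ?F" "length (set_comp_type d g) = length ?G"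
    by (simp_all add: set_comp_type_def)
  obtain k where k: "k < length (set_comp_type d f)" "i \<in> set_comp_type d f ! k" "?F ! k = f i"
    using set_comp_type_index[OF assms(2)] .
  obtain l where l: "l < length (set_comp_type d f)" "j \<in> set_comp_type d f ! l" "?F ! l = f j"
    using set_comp_type_index[OF assms(3)] .
  have "k < l"
  proof (rule ccontr)
    assume "\<not> k < l"
    then have "?F ! l \<le> ?F ! k"
      using k(1) len by (intro sorted_nth_mono) auto
    then show False using k l assms(4) by simp
  qed
  moreover have "g i = ?G ! k" "g j = ?G ! l"
    using k(1,2) l(1,2) unfolding assms(1) by (auto simp: set_comp_type_def)
  moreover have "l < length ?G"
    using l(1) len(2) assms(1) by metis
  then have "?G ! k < ?G ! l"
    by (rule sorted_wrt_nth_less[OF strict_sorted_list_of_set \<open>k < l\<close>])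
  ultimately show ?thesis by simp
qed

lemma inj_on_color_word: "inj_on (color_word d) (colorings d)"
proof (rule inj_onI)
  fix f g assume fg: "f \<in> colorings d" "g \<in> colorings d" "color_word d f = color_word d g"
  have "f i = g i" if "i \<in> {1..d}" for i
    using fg(3) that by (simp add: color_word_def del: upt_Suc)
  then show "f = g"
    using fg(1,2) unfolding colorings_def by (intro PiE_ext[of f _ _ g]) auto
qed

lemma Psi_color_word:
  assumes "f \<in> colorings d"
  shows "Psi d M (color_word d f) = (if generic M (\<lambda>i. real (f i)) then 1 else 0)"
proof -
  have "{g \<in> colorings d. generic M (\<lambda>i. real (g i)) \<and> color_word d g = color_word d f} =
      (if generic M (\<lambda>i. real (f i)) then {f} else {})"
    using assms inj_on_color_word[of d] by (auto dest: inj_onD)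
  then show ?thesis by (simp add: Psi_def)
qed

lemma Psi_in_WQSym:
  assumes M: "matroid_on {1..d} M"
  shows "Psi d M \<in> WQSym d"
proof -
  have gen: "generic M (\<lambda>i. real (g i))"
    if "generic M (\<lambda>i. real (f i))" "set_comp_type d f = set_comp_type d g" for f g
  proof -
    have "\<And>B. B \<in> M \<Longrightarrow> B \<subseteq> {1..d}"
      using M by (auto simp: matroid_on_def)
    then show ?thesis
      using that(1) set_comp_type_eq_imp_less[OF that(2)] unfolding generic_iff_exchange[OF M]
      by (meson DiffD1 of_nat_less_iff subsetD)
  qed
  have "u \<in> color_word d ` colorings d" if "Psi d M u \<noteq> 0" for u
  proof -
    have "{f \<in> colorings d. generic M (\<lambda>i. real (f i)) \<and> color_word d f = u} \<noteq> {}"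
      using that unfolding Psi_def by (metis card.empty of_nat_0)
    then show ?thesis by blast
  qed
  then show ?thesis
    using gen gen[OF _ sym] unfolding WQSym_def by (auto simp: Psi_color_word)
qed

lemma Psi_lin_Mat_subset: "Psi_lin d ` Mat d \<subseteq> WQSym d"
proof
  fix c assume "c \<in> Psi_lin d ` Mat d"
  then obtain p where p: "Poly_Mapping.keys p \<subseteq> {M. matroid_on {1..d} M}" "c = Psi_lin d p"
    by (auto simp: Mat_def)
  show "c \<in> WQSym d"
    unfolding p(2) Psi_lin_def
    using p(1) by (intro subspace_sum[OF subspace_WQSym] subspace_scale[OF subspace_WQSym]
        Psi_in_WQSym) auto
qed

lemma sorted_list_le_iff_count:
  fixes A B :: "nat set"
  assumes fin: "finite A" "finite B" and card: "card B = card A"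
  shows "(\<forall>i<card A. sorted_list_of_set B ! i \<le> sorted_list_of_set A ! i) \<longleftrightarrow>
    (\<forall>k. card (A \<inter> {..k}) \<le> card (B \<inter> {..k}))"
proof -
  have nth_le: "sorted_list_of_set S ! i \<le> k \<longleftrightarrow> i < card (S \<inter> {..k})"
    if S: "finite S" and i: "i < card S" for S :: "nat set" and i k
  proof -
    let ?s = "\<lambda>i. sorted_list_of_set S ! i"
    have less: "?s i < ?s j" if "i < j" "j < card S" for i j
      using sorted_wrt_nth_less[OF strict_sorted_list_of_set that(1), of S] that(2) S by simp
    have inj: "inj_on ?s {..<card S}"
      by (rule inj_onI) (metis less lessThan_iff less_irrefl linorder_neqE_nat)
    have img: "?s ` {..<card S} = S"
      using S by (metis nth_image order_refl sorted_list_of_set.length_sorted_key_list_of_set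
          sorted_list_of_set.set_sorted_key_list_of_set take_all_iff lessThan_atLeast0)
    have "S \<inter> {..k} = ?s ` {j\<in>{..<card S}. ?s j \<le> k}"
      using img by (auto simp: image_iff)
    then have c: "card (S \<inter> {..k}) = card {j\<in>{..<card S}. ?s j \<le> k}"
      using card_image[OF inj_on_subset[OF inj], of "{j\<in>{..<card S}. ?s j \<le> k}"] by auto
    show ?thesis
    proof
      assume le: "?s i \<le> k"
      have "?s j \<le> k" if "j \<le> i" for j
        using less[of j i] that i le by (cases "j = i") auto
      then have "{..i} \<subseteq> {j\<in>{..<card S}. ?s j \<le> k}"
        using i by auto
      from card_mono[OF _ this] show "i < card (S \<inter> {..k})"
        using c by simp
    next
      assume lt: "i < card (S \<inter> {..k})"
      show "?s i \<le> k"
      proof (rule ccontr)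
        assume "\<not> ?s i \<le> k"
        then have "j < i" if "j < card S" "?s j \<le> k" for j
          using less[of i j] that by (cases i j rule: linorder_cases) auto
        then have "{j\<in>{..<card S}. ?s j \<le> k} \<subseteq> {..<i}"
          by auto
        from card_mono[OF _ this] show False
          using c lt by simp
      qed
    qed
  qed
  show ?thesis
  proof
    assume L: "\<forall>i<card A. sorted_list_of_set B ! i \<le> sorted_list_of_set A ! i"
    show "\<forall>k. card (A \<inter> {..k}) \<le> card (B \<inter> {..k})"
    proof (rule allI, rule ccontr)
      fix k assume "\<not> card (A \<inter> {..k}) \<le> card (B \<inter> {..k})"
      then have lt: "card (B \<inter> {..k}) < card (A \<inter> {..k})" by simp
      moreover have "card (A \<inter> {..k}) \<le> card A"
        using fin by (intro card_mono) auto
      ultimately have i: "card (B \<inter> {..k}) < card A" by simp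
      then have "sorted_list_of_set B ! card (B \<inter> {..k}) \<le> k"
        using L nth_le[OF fin(1) i, of k] lt by (meson order_trans)
      then show False
        using nth_le[OF fin(2), of "card (B \<inter> {..k})" k] i card by simp
    qed
  next
    assume R: "\<forall>k. card (A \<inter> {..k}) \<le> card (B \<inter> {..k})"
    show "\<forall>i<card A. sorted_list_of_set B ! i \<le> sorted_list_of_set A ! i"
      using nth_le[OF fin(1)] nth_le[OF fin(2)] R card by (metis order_refl order_less_le_trans)
  qed
qed

lemma matroid_on_schubert_matroid:
  assumes A: "A \<subseteq> {1..d}"
  shows "matroid_on {1..d} (schubert_matroid d A)"
proof -
  have finA: "finite A" using A finite_subset by blast
  have mem: "B \<in> schubert_matroid d A \<longleftrightarrow>
      B \<subseteq> {1..d} \<and> card B = card A \<and> (\<forall>k. card (A \<inter> {..k}) \<le> card (B \<inter> {..k}))" for B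
    using sorted_list_le_iff_count[OF finA, of B] finite_subset[of B "{1..d}"]
    by (auto simp: schubert_matroid_def)
  have exch: "\<exists>y\<in>B' - B. insert y (B - {x}) \<in> schubert_matroid d A"
    if B: "B \<in> schubert_matroid d A" and B': "B' \<in> schubert_matroid d A" and x: "x \<in> B - B'"
    for B B' x
  proof -
    have fin: "finite B" "finite B'"
      using B B' mem finite_subset[OF _ finite_atLeastAtMost] by metis+
    have cards: "card B' = card B" "B \<subseteq> {1..d}" "B' \<subseteq> {1..d}"
      and counts: "\<And>k. card (A \<inter> {..k}) \<le> card (B \<inter> {..k})"
        "\<And>k. card (A \<inter> {..k}) \<le> card (B' \<inter> {..k})"
      using B B' by (simp_all add: mem)
    have "\<not> B' \<subseteq> B"
      using card_subset_eq[OF fin(1) _ cards(1)] x by blast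
    then have ne: "B' - B \<noteq> {}" by blast
    define y where "y = Min (B' - B)"
    have y: "y \<in> B' - B"
      unfolding y_def using ne fin by (intro Min_in) auto
    have ymin: "y \<le> z" if "z \<in> B' - B" for z
      unfolding y_def using that fin by (intro Min_le) auto
    let ?C = "insert y (B - {x})"
    have "card ?C = card B"
      using x y fin by (metis DiffD1 DiffD2 card_Suc_Diff1 card_insert_disjoint finite_Diff)
    moreover have "?C \<subseteq> {1..d}"
      using cards y by auto
    moreover have "card (A \<inter> {..k}) \<le> card (?C \<inter> {..k})" for k
    proof (cases "x \<le> k \<and> k < y")
      case True
      have "B' \<inter> {..k} \<subseteq> ?C \<inter> {..k}"
        using ymin True x by force
      then have "card (B' \<inter> {..k}) \<le> card (?C \<inter> {..k})"
        using fin by (intro card_mono) auto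
      then show ?thesis
        using counts(2)[of k] by simp
    next
      case False
      have "card (B \<inter> {..k}) \<le> card (?C \<inter> {..k})"
      proof (cases "x \<le> k")
        case True
        then have "y \<le> k" using False by simp
        then have "?C \<inter> {..k} = insert y ((B \<inter> {..k}) - {x})" by auto
        moreover have "card \<dots> = card (B \<inter> {..k})"
          using x y fin True by (subst card_insert_disjoint) (auto intro!: card.remove[symmetric]
              simp del: card_Diff_insert)
        ultimately show ?thesis by simp
      next
        case False
        then show ?thesis using fin by (intro card_mono) auto
      qed
      then show ?thesis
        using counts(1)[of k] by simp
    qed
    ultimately have "?C \<in> schubert_matroid d A"
      using B mem by simp
    with y show ?thesis by blast
  qed
  have "A \<in> schubert_matroid d A"
    using A by (simp add: mem)
  then show ?thesis
    unfolding matroid_on_def using exch by (auto simp: schubert_matroid_def)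
qed

end

theory Submission
  imports Defs
begin

text \<open>For \<open>A\<close> not of the form \<open>{1..k}\<close>, let \<open>x\<close> be the least element of \<open>{1..d} - A\<close> and
  \<open>y\<close> the largest element of \<open>A\<close>, so \<open>x < y\<close>. Colour \<open>A - {y}\<close> injectively on top, give \<open>x\<close> and
  \<open>y\<close> a common colour below that, and colour the remaining elements injectively at the bottom.
  This colouring is not generic for \<open>SM(A)\<close>, since \<open>A\<close> and \<open>A - {y} \<union> {x}\<close> are both optimal. If it
  is not generic for \<open>SM(A')\<close>, the tie between \<open>x\<close> and \<open>y\<close> yields an optimal basis of \<open>SM(A')\<close>
  containing \<open>y\<close> but not \<open>x\<close>; as bases of \<open>SM(A')\<close> may be moved down, this basis is \<open>A\<close>, so
  \<open>A \<le> A'\<close> componentwise. Thus the matrix of non-generic pairs is unitriangular. The matroids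
  \<open>SM({1..k})\<close>, \<open>0 \<le> k \<le> d\<close>, all have the same \<open>\<Psi>\<close>; we keep the one with \<open>k = 0\<close>, and it is
  separated from the others by an injective colouring.\<close>

section \<open>Exchanges and the componentwise order\<close>

lemma sum_insert_remove:
  fixes f :: "'a \<Rightarrow> 'b::ab_group_add"
  assumes "finite B" "p \<in> B" "q \<notin> B"
  shows "sum f (insert q (B - {p})) = sum f B - f p + f q"
  using assms by (simp add: sum_diff1)

lemma card_insert_remove_eq:
  assumes "finite B" "p \<in> B" "q \<notin> B"
  shows "card (insert q (B - {p})) = card B"
  using assms by (metis DiffD1 card_Suc_Diff1 card_insert_disjoint finite_Diff)

lemma schubert_matroid_iff_count:
  assumes "A \<subseteq> {1..d}"
  shows "B \<in> schubert_matroid d A \<longleftrightarrow>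
    B \<subseteq> {1..d} \<and> card B = card A \<and> (\<forall>k. card (A \<inter> {..k}) \<le> card (B \<inter> {..k}))"
  using sorted_list_le_iff_count[of A B] finite_subset[OF assms] finite_subset[of B "{1..d}"]
  by (auto simp: schubert_matroid_def)

lemma schubert_matroid_self: "A \<subseteq> {1..d} \<Longrightarrow> A \<in> schubert_matroid d A"
  by (simp add: schubert_matroid_def)

text \<open>Moving an element from \<open>z\<close> down to \<open>x\<close> never lowers a prefix
  count: for \<open>k \<ge> z\<close> it trades one counted element for another, and for
  \<open>k < z\<close> nothing counted is lost.\<close>

lemma schubert_matroid_lower:
  assumes A: "A \<subseteq> {1..d}" and B: "B \<in> schubert_matroid d A"
    and x: "1 \<le> x" "x \<notin> B" and z: "z \<in> B" "x < z"
  shows "insert x (B - {z}) \<in> schubert_matroid d A"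
proof -
  have B': "B \<subseteq> {1..d}" "card B = card A" "\<And>k. card (A \<inter> {..k}) \<le> card (B \<inter> {..k})"
    using B unfolding schubert_matroid_iff_count[OF A] by auto
  have fin: "finite B" using B'(1) finite_subset by blast
  have "card (B \<inter> {..k}) \<le> card (insert x (B - {z}) \<inter> {..k})" for k
  proof (cases "z \<le> k")
    case True
    then have "insert x (B - {z}) \<inter> {..k} = insert x ((B \<inter> {..k}) - {z})"
      using z by auto
    then show ?thesis
      using card_insert_remove_eq[of "B \<inter> {..k}" z x] fin x z True by simp
  next
    case False
    then show ?thesis using fin by (intro card_mono) auto
  qed
  then show ?thesis
    unfolding schubert_matroid_iff_count[OF A]
    using B' card_insert_remove_eq[OF fin z(1) x(2)] x z by (auto intro: order_trans)
qed

text \<open>The element sum is strictly monotone for the componentwise order, which provides a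
  numerical measure for the triangular induction.\<close>

lemma sum_less_if_in_schubert_matroid:
  assumes A: "finite A" and B: "B \<in> schubert_matroid d A" and "B \<noteq> A"
  shows "\<Sum>B < \<Sum>A"
proof -
  let ?a = "\<lambda>i. sorted_list_of_set A ! i" and ?b = "\<lambda>i. sorted_list_of_set B ! i"
  have fin: "finite B" and card: "card B = card A" and le: "\<And>i. i < card A \<Longrightarrow> ?b i \<le> ?a i"
    using B finite_subset[of B "{1..d}"] by (auto simp: schubert_matroid_def)
  have sum: "\<Sum>C = (\<Sum>i<card C. sorted_list_of_set C ! i)" if "finite C" for C :: "nat set"
    using that sum_list_sum_nth[of "sorted_list_of_set C"]
      sum_list_distinct_conv_sum_set[of "sorted_list_of_set C" "\<lambda>x. x"]
    by (simp add: lessThan_atLeast0)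
  have "sorted_list_of_set B \<noteq> sorted_list_of_set A"
    using \<open>B \<noteq> A\<close> A fin by (metis sorted_list_of_set.set_sorted_key_list_of_set)
  then obtain i where "i < card A" "?b i \<noteq> ?a i"
    using A fin card by (metis nth_equalityI sorted_list_of_set.length_sorted_key_list_of_set)
  then have "\<exists>i\<in>{..<card A}. ?b i < ?a i"
    using le by (metis lessThan_iff order_le_less)
  then have "(\<Sum>i<card A. ?b i) < (\<Sum>i<card A. ?a i)"
    using le by (intro sum_strict_mono_ex1) auto
  then show ?thesis
    using sum[OF A] sum[OF fin] card by simp
qed

section \<open>Ties and genericity\<close>

text \<open>The exchange criterion fails at every basis, in particular at one of maximum weight.
  There the offending exchange cannot gain weight either, so it is an exact tie.\<close>

lemma not_generic_obtains_tie:
  assumes M: "matroid_on E M" and "\<not> generic M f"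
  obtains B p q where "B \<in> M" "p \<in> B" "q \<in> E - B" "insert q (B - {p}) \<in> M" "f p = f q"
    "\<And>C. C \<in> M \<Longrightarrow> sum f C \<le> sum f B"
proof -
  have fin: "finite E" and ne: "M \<noteq> {}" and sub: "\<And>B. B \<in> M \<Longrightarrow> B \<subseteq> E"
    using M by (auto simp: matroid_on_def)
  have finM: "finite M"
    by (rule finite_subset[of _ "Pow E"]) (use fin sub in auto)
  have "Max (sum f ` M) \<in> sum f ` M"
    using finM ne by (intro Max_in) auto
  then obtain B where B: "B \<in> M" "sum f B = Max (sum f ` M)"
    by (metis imageE)
  have max: "sum f C \<le> sum f B" if "C \<in> M" for C
    unfolding B(2) using finM that by (intro Max_ge) auto
  obtain p q where pq: "p \<in> B" "q \<in> E - B" "insert q (B - {p}) \<in> M" "\<not> f q < f p"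
    using assms(2) B(1) unfolding generic_iff_exchange[OF M] by blast
  have "f p = f q"
    using max[OF pq(3)] sum_insert_remove[of B p q f] pq finite_subset[OF sub[OF B(1)] fin] by simp
  then show thesis
    using that[OF B(1) pq(1-3)] max by blast
qed

lemma generic_if_inj_on:
  assumes "matroid_on E M" "inj_on f E"
  shows "generic M f"
proof (rule ccontr)
  assume "\<not> generic M f"
  then obtain B p q where "B \<in> M" "p \<in> B" "q \<in> E - B" "f p = f q"
    using not_generic_obtains_tie[OF assms(1)] by metis
  then show False
    using assms unfolding matroid_on_def by (metis Diff_iff inj_onD subsetD)
qed

section \<open>The tie colouring\<close>

text \<open>Labels are at most \<open>d\<close>, so the offset \<open>d + 1\<close> keeps three
  bands apart: colours up to \<open>d\<close>, the tied colour \<open>d + 1\<close>, and colours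
  above it.\<close>

definition tie_coloring :: "nat \<Rightarrow> nat set \<Rightarrow> nat \<Rightarrow> nat" where
  "tie_coloring d A = (\<lambda>i\<in>{1..d}.
     if i = Min ({1..d} - A) \<or> i = Max A then d + 1 else if i \<in> A then d + 1 + i else i)"

lemma tie_coloring_in_colorings: "tie_coloring d A \<in> colorings d"
  by (auto simp: tie_coloring_def colorings_def)

text \<open>If the first gap were not below the maximum, \<open>A\<close> would contain everything
  up to its maximum and be an initial segment.\<close>

lemma Min_compl_less_Max_if_not_initial:
  fixes A :: "nat set"
  assumes A: "A \<subseteq> {1..d}" and ni: "\<And>k. k \<le> d \<Longrightarrow> A \<noteq> {1..k}"
  shows "Min ({1..d} - A) \<in> {1..d} - A" "Max A \<in> A" "Min ({1..d} - A) < Max A"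
proof -
  have fin: "finite A" using A finite_subset by blast
  have "A \<noteq> {}" using ni[of 0] by simp
  then show y: "Max A \<in> A" using fin by simp
  have "{1..d} - A \<noteq> {}" using A ni[of d] by auto
  then show x: "Min ({1..d} - A) \<in> {1..d} - A"
    by (intro Min_in) auto
  show "Min ({1..d} - A) < Max A"
  proof (rule ccontr)
    assume n: "\<not> Min ({1..d} - A) < Max A"
    have "A = {1..Max A}"
    proof
      show "A \<subseteq> {1..Max A}" using A fin by auto
      show "{1..Max A} \<subseteq> A"
      proof
        fix i assume i: "i \<in> {1..Max A}"
        show "i \<in> A"
        proof (rule ccontr)
          assume "i \<notin> A"
          moreover have "i \<le> d" using i y A by auto
          ultimately have "Min ({1..d} - A) \<le> i" using i by (intro Min_le) auto
          then have "i = Max A" using i n by simp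
          then show False using y \<open>i \<notin> A\<close> by simp
        qed
      qed
    qed
    then show False using ni[of "Max A"] y A by auto
  qed
qed

lemma not_generic_tie_coloring_self:
  assumes A: "A \<subseteq> {1..d}" and ni: "\<And>k. k \<le> d \<Longrightarrow> A \<noteq> {1..k}"
  shows "\<not> generic (schubert_matroid d A) (\<lambda>i. real (tie_coloring d A i))"
proof
  define x y where "x = Min ({1..d} - A)" and "y = Max A"
  let ?f = "\<lambda>i. real (tie_coloring d A i)" and ?M = "schubert_matroid d A"
  note xy = Min_compl_less_Max_if_not_initial[OF A ni, folded x_def y_def]
  have fin: "finite A" using A finite_subset by blast
  assume "generic ?M ?f"
  then have uniq: "B = C" if "is_arg_max (sum ?f) (\<lambda>B. B \<in> ?M) B"
    "is_arg_max (sum ?f) (\<lambda>B. B \<in> ?M) C" for B C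
    using that unfolding generic_def by blast
  have max: "sum ?f B \<le> sum ?f A" if B: "B \<in> ?M" for B
  proof -
    have Bd: "B \<subseteq> {1..d}" "card B = card A"
      using B by (auto simp: schubert_matroid_def)
    have finB: "finite B" using Bd finite_subset by blast
    \<comment> \<open>Only the equally large differences matter: colours outside \<open>A\<close>
      are at most \<open>d + 1\<close>, those in \<open>A\<close> at least
      \<open>d + 1\<close>.\<close>
    have "card (B - A) = card (A - B)"
      using Bd fin finB by (simp add: card_Diff_subset_Int Int_commute)
    moreover have "sum ?f (B - A) \<le> real (card (B - A)) * (d + 1)"
      using Bd xy by (intro sum_bounded_above) (auto simp: tie_coloring_def y_def)
    moreover have "real (card (A - B)) * (d + 1) \<le> sum ?f (A - B)"
      using A by (intro sum_bounded_below) (auto simp: tie_coloring_def)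
    moreover have "sum ?f B = sum ?f (B - A) + sum ?f (A \<inter> B)"
      using sum.Int_Diff[OF finB, of ?f A] by (simp add: Int_commute)
    moreover have "sum ?f A = sum ?f (A - B) + sum ?f (A \<inter> B)"
      using sum.Int_Diff[OF fin, of ?f B] by simp
    ultimately show ?thesis by simp
  qed
  let ?C = "insert x (A - {y})"
  have "?C \<in> ?M"
    using xy by (intro schubert_matroid_lower A schubert_matroid_self) auto
  moreover have "sum ?f ?C = sum ?f A"
    using xy A by (subst sum_insert_remove[OF fin])
      (auto simp: tie_coloring_def x_def y_def)
  ultimately have "?C = A"
    using max schubert_matroid_self[OF A]
    by (intro uniq) (auto simp: is_arg_max_linorder)
  then show False using xy by blast
qed

lemma schubert_matroid_if_not_generic_tie_coloring:
  assumes A: "A \<subseteq> {1..d}" and ni: "\<And>k. k \<le> d \<Longrightarrow> A \<noteq> {1..k}" and A': "A' \<subseteq> {1..d}"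
    and ng: "\<not> generic (schubert_matroid d A') (\<lambda>i. real (tie_coloring d A i))"
  shows "A \<in> schubert_matroid d A'"
proof -
  define x y where "x = Min ({1..d} - A)" and "y = Max A"
  let ?f = "\<lambda>i. real (tie_coloring d A i)" and ?M = "schubert_matroid d A'"
  note xy = Min_compl_less_Max_if_not_initial[OF A ni, folded x_def y_def]
  have fin: "finite A" using A finite_subset by blast
  have f_xy: "?f x = d + 1" "?f y = d + 1"
    using xy A by (auto simp: tie_coloring_def x_def y_def)
  have f_in: "?f i = d + 1 + i" if "i \<in> A" "i \<noteq> y" for i
    using xy that A by (auto simp: tie_coloring_def x_def y_def)
  have f_out: "?f i = i" if "i \<in> {1..d} - A" "i \<noteq> x" for i
    using xy that by (auto simp: tie_coloring_def x_def y_def)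
  have sub: "B \<subseteq> {1..d}" "finite B" if "B \<in> ?M" for B
    using that finite_subset[of B "{1..d}"] by (auto simp: schubert_matroid_def)
  obtain B p q where B: "B \<in> ?M" "p \<in> B" "q \<in> {1..d} - B" "insert q (B - {p}) \<in> ?M" "?f p = ?f q"
    and max: "\<And>C. C \<in> ?M \<Longrightarrow> sum ?f C \<le> sum ?f B"
    using not_generic_obtains_tie[OF matroid_on_schubert_matroid[OF A'] ng] by metis
  \<comment> \<open>The colouring is injective apart from the shared colour of \<open>x\<close> and
    \<open>y\<close>.\<close>
  have tie: "{p, q} = {x, y}"
  proof -
    have val: "tie_coloring d A i =
        (if i \<in> {x, y} then d + 1 else if i \<in> A then d + 1 + i else i)" if "i \<in> {1..d}" for i
      using that by (simp add: tie_coloring_def x_def y_def)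
    have pq: "p \<in> {1..d}" "q \<in> {1..d}" "p \<noteq> q"
      using sub(1)[OF B(1)] B(2,3) by auto
    then show ?thesis
      using B(5) unfolding of_nat_eq_iff val[OF pq(1)] val[OF pq(2)]
      by (auto split: if_splits)
  qed
  \<comment> \<open>Of the two tied bases, take the one that contains \<open>y\<close>.\<close>
  have "\<exists>C\<in>?M. x \<notin> C \<and> y \<in> C \<and> sum ?f C = sum ?f B"
  proof (cases "p = y")
    case True
    then show ?thesis using B tie by (intro bexI[of _ B]) auto
  next
    case False
    then have "p = x" "q = y" using tie by (auto simp: doubleton_eq_iff)
    moreover have "sum ?f (insert q (B - {p})) = sum ?f B"
      using B sub by (subst sum_insert_remove) auto
    ultimately show ?thesis using B xy by (intro bexI[of _ "insert q (B - {p})"]) auto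
  qed
  then obtain C where C: "C \<in> ?M" "x \<notin> C" "y \<in> C" "\<And>D. D \<in> ?M \<Longrightarrow> sum ?f D \<le> sum ?f C"
    using max by metis
  \<comment> \<open>Moving down stays inside the matroid, so it cannot increase the weight of the
    optimal \<open>C\<close>.\<close>
  have lower: "?f u \<le> ?f v" if "v \<in> C" "u \<notin> C" "u < v" "1 \<le> u" for u v
    using C(4)[OF schubert_matroid_lower[OF A' C(1), of u v]] that
      sum_insert_remove[OF sub(2)[OF C(1)], of v u ?f] by simp
  have "C = A"
  proof
    \<comment> \<open>A missing \<open>z\<close> lies below \<open>y\<close> but has a larger
      colour, so replacing \<open>y\<close> by \<open>z\<close> would gain weight.\<close>
    show "A \<subseteq> C"
    proof (rule subsetI, rule ccontr)
      fix z assume z: "z \<in> A" "z \<notin> C"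
      then have "z \<noteq> y" "z \<le> y" "1 \<le> z"
        using C fin A by (auto simp: y_def)
      then show False
        using lower[of y z] z C f_xy f_in by simp
    qed
    \<comment> \<open>An extra \<open>z\<close> lies above the first gap \<open>x\<close> but has a
      smaller colour, so replacing \<open>z\<close> by \<open>x\<close> would gain weight.\<close>
    show "C \<subseteq> A"
    proof (rule subsetI, rule ccontr)
      fix z assume z: "z \<in> C" "z \<notin> A"
      then have "z \<in> {1..d} - A" "z \<noteq> x" using C(2) sub(1)[OF C(1)] by auto
      moreover from this have "x \<le> z" unfolding x_def by (intro Min_le) auto
      ultimately show False
        using lower[of z x] z C xy f_xy f_out[of z] by auto
    qed
  qed
  with C(1) show ?thesis by simp
qed

section \<open>Triangular elimination of coefficients\<close>

lemma schubert_Psi_scalars_zero: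
  fixes c :: "nat set \<Rightarrow> real" and d :: nat
  defines "T \<equiv> Pow {1..d} - (\<lambda>k. {1..k}) ` {1..d}"
  assumes zero: "(\<Sum>A\<in>T. c A *\<^sub>R Psi d (schubert_matroid d A)) = 0" and A: "A \<in> T"
  shows "c A = 0"
proof -
  have fin: "finite T" by (simp add: T_def)
  have sub: "A \<subseteq> {1..d}" if "A \<in> T" for A using that by (simp add: T_def)
  \<comment> \<open>Reading off the coefficient of one word gives one scalar equation per
    colouring.\<close>
  have eval: "(\<Sum>A\<in>T. if generic (schubert_matroid d A) (\<lambda>i. real (f i)) then c A else 0) = 0"
    if "f \<in> colorings d" for f
  proof -
    have "(\<Sum>A\<in>S. v A) w = (\<Sum>A\<in>S. v A w)" if "finite S"
      for S :: "nat set set" and v :: "nat set \<Rightarrow> word_series" and w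
      using that by (induction S) simp_all
    from this[OF fin] have "(\<Sum>A\<in>T. c A * Psi d (schubert_matroid d A) (color_word d f)) = 0"
      using fun_cong[OF zero, of "color_word d f"] by simp
    then show ?thesis
      unfolding Psi_color_word[OF that] by (simp add: if_distrib cong: if_cong)
  qed
  \<comment> \<open>An injective colouring is generic for all the matroids, so its equation says
    that all coefficients add up to zero.\<close>
  have "generic (schubert_matroid d A) (\<lambda>i. real ((\<lambda>i\<in>{1..d}. i) i))" if "A \<in> T" for A
    using sub[OF that] by (intro generic_if_inj_on[OF matroid_on_schubert_matroid])
      (auto intro: inj_onI)
  moreover have "(\<lambda>i\<in>{1..d}. i) \<in> colorings d"
    by (auto simp: colorings_def)
  ultimately have total: "sum c T = 0"
    using eval[of "\<lambda>i\<in>{1..d}. i"] by simp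
  have nonempty: "c A = 0" if "A \<in> T" "A \<noteq> {}" for A
    using that
  \<comment> \<open>Sets with larger sum come first. No subset exceeds \<open>\<Sum>{1..d}\<close>,
    so the truncated subtraction does not spoil the measure.\<close>
  proof (induction "\<Sum>{1..d} - \<Sum>A" arbitrary: A rule: less_induct)
    case less
    let ?g = "\<lambda>A'. generic (schubert_matroid d A') (\<lambda>i. real (tie_coloring d A i))"
    have ni: "A \<noteq> {1..k}" if "k \<le> d" for k
      using less.prems that by (cases "k = 0") (auto simp: T_def)
    have rest: "c A' = 0" if A': "A' \<in> T" "A' \<noteq> A" "\<not> ?g A'" for A'
    proof -
      have mem: "A \<in> schubert_matroid d A'"
        using schubert_matroid_if_not_generic_tie_coloring[OF sub[OF less.prems(1)] ni sub]
          A' by blast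
      have "finite A'" using sub[OF A'(1)] finite_subset by blast
      then have "\<Sum>A < \<Sum>A'"
        using sum_less_if_in_schubert_matroid[OF _ mem] A'(2) by blast
      moreover have "\<Sum>A' \<le> \<Sum>{1..d}"
        using sub[OF A'(1)] by (intro sum_mono2) auto
      ultimately show ?thesis
        using A'(1) by (intro less.hyps) auto
    qed
    have "(\<Sum>A'\<in>T - {A}. if ?g A' then 0 else c A') = 0"
      using rest by (intro sum.neutral) simp
    \<comment> \<open>Among the non-generic terms only \<open>A\<close> survives; their sum is the
      total minus the generic part, and both vanish.\<close>
    then have "c A = (\<Sum>A'\<in>T. if ?g A' then 0 else c A')"
      using not_generic_tie_coloring_self[OF sub[OF less.prems(1)] ni]
      by (subst sum.remove[OF fin less.prems(1)]) simp
    also have "\<dots> = sum c T - (\<Sum>A'\<in>T. if ?g A' then c A' else 0)"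
      unfolding sum_subtractf[symmetric] by (intro sum.cong) auto
    also have "\<dots> = 0"
      using total eval[OF tie_coloring_in_colorings] by simp
    finally show ?case .
  qed
  have "sum c T = c {}"
    using nonempty by (subst sum.remove[OF fin, of "{}"]) (auto simp: T_def intro!: sum.neutral)
  with nonempty[OF A] total show ?thesis by metis
qed

section \<open>Independence and dimension\<close>

lemma independent_image_if_scalars_zero:
  fixes v :: "'a \<Rightarrow> 'b::real_vector"
  assumes fin: "finite T"
    and zero: "\<And>c a. (\<Sum>a\<in>T. c a *\<^sub>R v a) = 0 \<Longrightarrow> a \<in> T \<Longrightarrow> c a = 0"
  shows "inj_on v T" "independent (v ` T)"
proof -
  show inj: "inj_on v T"
  proof (rule inj_onI, rule ccontr)
    fix a b assume ab: "a \<in> T" "b \<in> T" "v a = v b" "a \<noteq> b"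
    \<comment> \<open>Equal vectors at distinct indices would give the relation
      \<open>v a - v b = 0\<close>.\<close>
    let ?c = "\<lambda>i. (if i = a then 1 else 0) - (if i = b then 1 else 0 :: real)"
    have "(\<Sum>i\<in>T. ?c i *\<^sub>R v i) = 0"
      using fin ab by (simp add: scaleR_diff_left sum_subtractf if_distrib[of "\<lambda>r. r *\<^sub>R _"]
          cong: if_cong)
    from zero[OF this ab(1)] ab(4) show False by simp
  qed
  show "independent (v ` T)"
  proof (rule independent_if_scalars_zero)
    show "finite (v ` T)" using fin by simp
    fix g x assume "(\<Sum>x\<in>v ` T. g x *\<^sub>R x) = 0" "x \<in> v ` T"
    then show "g x = 0"
      using zero[of "\<lambda>a. g (v a)"] by (auto simp: sum.reindex[OF inj])
  qed
qed

text \<open>\<open>dim\<close> is a cardinality in \<open>nat\<close> and would be 0 for an infinite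
  basis; the finite spanning set \<open>F\<close> excludes this inside the infinite-dimensional
  space of series.\<close>

lemma card_le_dim_if_finite_span:
  fixes B :: "'a::real_vector set"
  assumes B: "independent B" "B \<subseteq> V" and F: "finite F" "V \<subseteq> span F"
  shows "card B \<le> dim V"
proof -
  obtain C where C: "B \<subseteq> C" "C \<subseteq> V" "independent C" "V \<subseteq> span C"
    using maximal_independent_subset_extend[OF B(2,1)] by metis
  have "finite C"
    using independent_span_bound[OF F(1) C(3)] C(2) F(2) by blast
  moreover have "span C = span V"
    using C(2,4) by (metis span_minimal span_mono subspace_span subset_antisym)
  ultimately show ?thesis
    using dim_eq_card[OF _ C(3)] card_mono[OF _ C(1)] by metis
qed

theorem theorem1p2:
  fixes d :: nat
  shows "dim (Psi_lin d ` Mat d) \<ge> 2 ^ d - d \<and>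
    (\<exists>S. S \<subseteq> schubert_matroid d ` Pow {1..d} \<and> card S = 2 ^ d - d \<and>
         inj_on (Psi d) S \<and> independent (Psi d ` S))"
proof -
  let ?T = "Pow {1..d} - (\<lambda>k. {1..k}) ` {1..d}"
  let ?S = "schubert_matroid d ` ?T"
  have indep: "inj_on (\<lambda>A. Psi d (schubert_matroid d A)) ?T"
    "independent ((\<lambda>A. Psi d (schubert_matroid d A)) ` ?T)"
    by (rule independent_image_if_scalars_zero, simp, rule schubert_Psi_scalars_zero, assumption+)+
  then have S: "inj_on (schubert_matroid d) ?T" "inj_on (Psi d) ?S" "independent (Psi d ` ?S)"
    by (auto simp: image_image inj_on_def)
  have "inj_on (\<lambda>k. {1..k}) {1..d}"
    by (rule inj_onI) (auto simp: atLeastatMost_subset_iff set_eq_subset)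
  then have "card ?T = 2 ^ d - d"
    by (subst card_Diff_subset) (auto simp: card_image card_Pow)
  then have card: "card ?S = 2 ^ d - d"
    using S(1) by (simp add: card_image)
  \<comment> \<open>There are only finitely many matroids on \<open>{1..d}\<close>, so their series
    form a finite spanning set for the image.\<close>
  let ?F = "Psi d ` {M. matroid_on {1..d} M}"
  have "{M. matroid_on {1..d} M} \<subseteq> Pow (Pow {1..d})"
    by (auto simp: matroid_on_def)
  then have fin: "finite ?F"
    using finite_subset by (metis finite_Pow_iff finite_atLeastAtMost finite_imageI)
  have "Psi_lin d p \<in> span ?F" if "p \<in> Mat d" for p
    using that unfolding Psi_lin_def Mat_def
    by (intro span_sum span_scale span_base) auto
  then have span: "Psi_lin d ` Mat d \<subseteq> span ?F" by blast
  have "Psi d M \<in> Psi_lin d ` Mat d" if "M \<in> ?S" for M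
    using that matroid_on_schubert_matroid
    by (intro image_eqI[of _ _ "Poly_Mapping.single M 1"]) (auto simp: Mat_def)
  then have "card (Psi d ` ?S) \<le> dim (Psi_lin d ` Mat d)"
    by (intro card_le_dim_if_finite_span[OF S(3) _ fin span]) blast
  then have "2 ^ d - d \<le> dim (Psi_lin d ` Mat d)"
    using card S(2) by (simp add: card_image)
  moreover have "?S \<subseteq> schubert_matroid d ` Pow {1..d}"
    by (intro image_mono) simp
  ultimately show ?thesis
    using card S(2,3) by (intro conjI exI[of _ ?S])
qed

end
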